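(* Let $X$ be an Archimedean vector lattice and let $f:\mathbb{R}_+\to X$ be an ru-continuous and ru-integrable function. Then the ru-integral $s\mapsto\int_0^sf(t)\,\mathrm{d}t$ of $f$ is ru-differentiable and its ru-derivative equals $f$.
   Context: A function $f:\mathbb{R}_+\to X$ is ru-continuous if there is a continuity regulator $u:\mathbb{R}_+\to X$ such that for each $\varepsilon>0$ there is $\delta>0$ with $|f(t+h)-f(t)|\le\varepsilon u(t)$ for all $t\ge0$ and $h\in[-\min\{\delta,t\},\delta]$. A function $f:\mathbb{R}_+\to X$ is ru-differentiable with ru-derivative $f':\mathbb{R}_+\to X$ if there is a differentiation regulator $u:\mathbb{R}_+\to X$ such that for each $\varepsilon>0$ there is $\delta>0$ with $\left|\frac{f(t+h)-f(t)}{h}-f'(t)\right|\le\varepsilon u(t)$ for all $t\ge0$ and $h\in[-\min\{\delta,t\},\delta]$, $h\ne0$. A function $f:\mathbb{R}_+\to X$ is ru-integrable on $[0,s]$ if there are $I_s\in X$ and a regulator $u_s\in X$ such that for each $\varepsilon>0$ there is $\delta>0$ with $\left|\sum_{i=1}^n(s_i-s_{i-1})f(t_i)-I_s\right|\le\varepsilon u_s$ for every partition $\{s_0,\dots,s_n\}$ of $[0,s]$ with $\max_i|s_i-s_{i-1}|\le\delta$ and all $t_i\in[s_{i-1},s_i]$; then $\int_0^sf(t)\,\mathrm{d}t:=I_s$ (it is unique). $f$ is ru-integrable if it is ru-integrable on $[0,s]$ for all $s\ge0$, and the map $s\mapsto\int_0^sf(t)\,\mathrm{d}t$ is called the ru-integral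 of $f$. *)

theory Defs
  imports "HOL-Analysis.Analysis" "HOL-Library.Lattice_Algebras"
begin

(* The modulus is the lattice modulus: |x| = sup x (- x) is the axiom abs_lattice of
   lattice_ab_group_add_abs. *)
class vector_lattice = ordered_real_vector + lattice_ab_group_add_abs

class archimedean_vector_lattice = vector_lattice +
  assumes archimedean_vl:
    "\<lbrakk>0 \<le> x; 0 \<le> y; \<forall>n::nat. real n *\<^sub>R x \<le> y\<rbrakk> \<Longrightarrow> x = 0"

instance real :: archimedean_vector_lattice
proof
  fix x y :: real
  assume "0 \<le> x" "0 \<le> y" and le: "\<forall>n::nat. real n *\<^sub>R x \<le> y"
  show "x = 0"
  proof (rule ccontr)
    assume "x \<noteq> 0"
    with \<open>0 \<le> x\<close> obtain n :: nat where "y < real n * x"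
      using reals_Archimedean3[of x] by auto
    with le show False
      by (simp add: not_less[symmetric])
  qed
qed

(* Functions on [0, \<infinity>) are rendered as functions on real; the definitions below inspect
   them on [0, \<infinity>) only. *)

definition ru_continuous :: "(real \<Rightarrow> 'a::vector_lattice) \<Rightarrow> bool" where
  "ru_continuous f \<longleftrightarrow>
    (\<exists>u :: real \<Rightarrow> 'a. \<forall>\<epsilon>>0. \<exists>\<delta>>0. \<forall>t\<ge>0. \<forall>h\<in>{- min \<delta> t..\<delta>}.
      \<bar>f (t + h) - f t\<bar> \<le> \<epsilon> *\<^sub>R u t)"

definition has_ru_derivative ::
    "(real \<Rightarrow> 'a::vector_lattice) \<Rightarrow> (real \<Rightarrow> 'a) \<Rightarrow> bool" (infix "has'_ru'_derivative" 50) where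
  "f has_ru_derivative f' \<longleftrightarrow>
    (\<exists>u :: real \<Rightarrow> 'a. \<forall>\<epsilon>>0. \<exists>\<delta>>0. \<forall>t\<ge>0. \<forall>h\<in>{- min \<delta> t..\<delta>}. h \<noteq> 0 \<longrightarrow>
      \<bar>(f (t + h) - f t) /\<^sub>R h - f' t\<bar> \<le> \<epsilon> *\<^sub>R u t)"

(* For a = b only n = 0 is possible. *)
definition is_partition :: "real \<Rightarrow> real \<Rightarrow> nat \<Rightarrow> (nat \<Rightarrow> real) \<Rightarrow> bool" where
  "is_partition a b n p \<longleftrightarrow> p 0 = a \<and> p n = b \<and> (\<forall>i\<in>{1..n}. p (i - 1) < p i)"

definition has_ru_integral ::
    "(real \<Rightarrow> 'a::vector_lattice) \<Rightarrow> real \<Rightarrow> 'a \<Rightarrow> bool" where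
  "has_ru_integral f s I \<longleftrightarrow>
    (\<exists>u :: 'a. \<forall>\<epsilon>>0. \<exists>\<delta>>0. \<forall>n p \<tau>.
      is_partition 0 s n p \<and> (\<forall>i\<in>{1..n}. \<bar>p i - p (i - 1)\<bar> \<le> \<delta>) \<and>
      (\<forall>i\<in>{1..n}. \<tau> i \<in> {p (i - 1)..p i}) \<longrightarrow>
      \<bar>(\<Sum>i=1..n. (p i - p (i - 1)) *\<^sub>R f (\<tau> i)) - I\<bar> \<le> \<epsilon> *\<^sub>R u)"

definition ru_integrable :: "(real \<Rightarrow> 'a::vector_lattice) \<Rightarrow> bool" where
  "ru_integrable f \<longleftrightarrow> (\<forall>s\<ge>0. \<exists>I. has_ru_integral f s I)"

definition ru_integral :: "(real \<Rightarrow> 'a::vector_lattice) \<Rightarrow> real \<Rightarrow> 'a" where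
  "ru_integral f s = (THE I. has_ru_integral f s I)"

lemma fine_partition_exists:
  fixes s \<delta> :: real
  assumes "0 \<le> s" "0 < \<delta>"
  obtains n p where "is_partition 0 s n p" "\<forall>i\<in>{1..n}. \<bar>p i - p (i - 1)\<bar> \<le> \<delta>"
proof (cases "s = 0")
  case True
  show thesis
    by (rule that[of 0 "\<lambda>_. 0"]) (simp_all add: is_partition_def True)
next
  case False
  with assms have s: "0 < s" by simp
  obtain n :: nat where n: "s < real n * \<delta>"
    using reals_Archimedean3[OF assms(2)] by blast
  have n0: "0 < n" using n s by (cases n) auto
  define p where "p = (\<lambda>i::nat. s * real i / real n)"
  have step: "p i - p (i - 1) = s / real n" if "i \<in> {1..n}" for i
    using that n0 by (auto simp: p_def field_simps of_nat_diff)
  have pos: "0 < s / real n" and le: "s / real n \<le> \<delta>"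
    using s n0 n by (simp_all add: field_simps)
  show thesis
  proof (rule that[of n p])
    have "p (i - 1) < p i" if "i \<in> {1..n}" for i
      using step[OF that] pos by linarith
    then show "is_partition 0 s n p"
      using n0 by (simp add: is_partition_def p_def)
    show "\<forall>i\<in>{1..n}. \<bar>p i - p (i - 1)\<bar> \<le> \<delta>"
      using step pos le by (metis abs_of_pos)
  qed
qed

lemma has_ru_integral_unique:
  fixes f :: "real \<Rightarrow> 'a::archimedean_vector_lattice"
  assumes "0 \<le> s" "has_ru_integral f s I" "has_ru_integral f s J"
  shows "I = J"
proof -
  from assms(2) obtain u where u: "\<forall>\<epsilon>>0. \<exists>\<delta>>0. \<forall>n p \<tau>.
      is_partition 0 s n p \<and> (\<forall>i\<in>{1..n}. \<bar>p i - p (i - 1)\<bar> \<le> \<delta>) \<and>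
      (\<forall>i\<in>{1..n}. \<tau> i \<in> {p (i - 1)..p i}) \<longrightarrow>
      \<bar>(\<Sum>i=1..n. (p i - p (i - 1)) *\<^sub>R f (\<tau> i)) - I\<bar> \<le> \<epsilon> *\<^sub>R u"
    unfolding has_ru_integral_def by blast
  from assms(3) obtain v where v: "\<forall>\<epsilon>>0. \<exists>\<delta>>0. \<forall>n p \<tau>.
      is_partition 0 s n p \<and> (\<forall>i\<in>{1..n}. \<bar>p i - p (i - 1)\<bar> \<le> \<delta>) \<and>
      (\<forall>i\<in>{1..n}. \<tau> i \<in> {p (i - 1)..p i}) \<longrightarrow>
      \<bar>(\<Sum>i=1..n. (p i - p (i - 1)) *\<^sub>R f (\<tau> i)) - J\<bar> \<le> \<epsilon> *\<^sub>R v"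
    unfolding has_ru_integral_def by blast
  have key: "\<bar>I - J\<bar> \<le> \<epsilon> *\<^sub>R (u + v)" if "0 < \<epsilon>" for \<epsilon> :: real
  proof -
    obtain d where d: "d > 0" "\<forall>n p \<tau>.
        is_partition 0 s n p \<and> (\<forall>i\<in>{1..n}. \<bar>p i - p (i - 1)\<bar> \<le> d) \<and>
        (\<forall>i\<in>{1..n}. \<tau> i \<in> {p (i - 1)..p i}) \<longrightarrow>
        \<bar>(\<Sum>i=1..n. (p i - p (i - 1)) *\<^sub>R f (\<tau> i)) - I\<bar> \<le> \<epsilon> *\<^sub>R u"
      using u[THEN spec, THEN mp, OF \<open>0 < \<epsilon>\<close>] by (elim exE conjE) (rule that)
    obtain e where e: "e > 0" "\<forall>n p \<tau>.
        is_partition 0 s n p \<and> (\<forall>i\<in>{1..n}. \<bar>p i - p (i - 1)\<bar> \<le> e) \<and>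
        (\<forall>i\<in>{1..n}. \<tau> i \<in> {p (i - 1)..p i}) \<longrightarrow>
        \<bar>(\<Sum>i=1..n. (p i - p (i - 1)) *\<^sub>R f (\<tau> i)) - J\<bar> \<le> \<epsilon> *\<^sub>R v"
      using v[THEN spec, THEN mp, OF \<open>0 < \<epsilon>\<close>] by (elim exE conjE) (rule that)
    obtain n p where part: "is_partition 0 s n p"
      and mesh: "\<forall>i\<in>{1..n}. \<bar>p i - p (i - 1)\<bar> \<le> min d e"
      using fine_partition_exists[OF assms(1), of "min d e"] d(1) e(1) by auto
    have tags: "\<forall>i\<in>{1..n}. p i \<in> {p (i - 1)..p i}"
      using part by (auto simp: is_partition_def intro: less_imp_le)
    let ?S = "\<Sum>i=1..n. (p i - p (i - 1)) *\<^sub>R f (p i)"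
    have 1: "\<bar>?S - I\<bar> \<le> \<epsilon> *\<^sub>R u"
      using d(2)[THEN spec[of _ n], THEN spec[of _ p], THEN spec[of _ p]] part tags mesh by simp
    have 2: "\<bar>?S - J\<bar> \<le> \<epsilon> *\<^sub>R v"
      using e(2)[THEN spec[of _ n], THEN spec[of _ p], THEN spec[of _ p]] part tags mesh by simp
    have "\<bar>I - J\<bar> = \<bar>(?S - J) - (?S - I)\<bar>" by simp
    also have "\<dots> \<le> \<bar>?S - J\<bar> + \<bar>?S - I\<bar>" by (rule abs_triangle_ineq4)
    also have "\<dots> \<le> \<epsilon> *\<^sub>R v + \<epsilon> *\<^sub>R u" using 1 2 by (intro add_mono)
    finally show ?thesis by (simp add: scaleR_add_right add.commute)
  qed
  have "0 \<le> u + v"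
    using key[of 1] abs_ge_zero[of "I - J"] by (simp del: abs_ge_zero)
  have "real n *\<^sub>R \<bar>I - J\<bar> \<le> u + v" for n :: nat
  proof (cases "n = 0")
    case True
    then show ?thesis using \<open>0 \<le> u + v\<close> by simp
  next
    case False
    then have "real n *\<^sub>R \<bar>I - J\<bar> \<le> real n *\<^sub>R ((1 / real n) *\<^sub>R (u + v))"
      by (intro scaleR_left_mono key) simp_all
    then show ?thesis using False by simp
  qed
  then have "\<bar>I - J\<bar> = 0"
    using archimedean_vl[of "\<bar>I - J\<bar>" "u + v"] \<open>0 \<le> u + v\<close> by simp
  then show ?thesis by simp
qed

lemma ru_integral_eqI:
  fixes f :: "real \<Rightarrow> 'a::archimedean_vector_lattice"
  assumes "0 \<le> s" "has_ru_integral f s I"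
  shows "ru_integral f s = I"
  unfolding ru_integral_def using assms has_ru_integral_unique by blast

end

theory Submission
  imports Defs
begin

text \<open>
  Write \<open>F\<close> for the ru-integral of \<open>f\<close>. The usual proof of the fundamental theorem of calculus
  works, and a continuity regulator of \<open>f\<close> serves as a differentiation regulator of \<open>F\<close>. The
  difference quotient of \<open>F\<close> over an interval between \<open>t\<close> and \<open>t + h\<close> is a mean of values of \<open>f\<close>;
  by continuity all of these values lie within \<open>\<epsilon> u(t)\<close> of \<open>f(t)\<close>, hence so does the mean. As the
  \<open>\<delta>\<close> of the continuity condition does not depend on \<open>t\<close>, the same \<open>\<delta>\<close> works for \<open>F\<close>.

  The one step that needs care is the mean value estimate
  (\<open>ru_integral_mean_value_estimate\<close>). The integrals over \<open>[0,a]\<close> and \<open>[0,b]\<close> come with unrelated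
  regulators \<open>v\<close> and \<open>w\<close>, neither of which may survive in the result. A single
  partition of \<open>[0,b]\<close> that passes through \<open>a\<close> makes the Riemann sums over \<open>[0,a]\<close> cancel, up to an
  error \<open>\<eta> (v + w)\<close> with arbitrary \<open>\<eta> > 0\<close>. The Archimedean property removes this error.
\<close>

section \<open>Order estimates\<close>

lemma abs_scaleR_le:
  fixes x y :: "'a::vector_lattice"
  assumes "0 \<le> r" "\<bar>x\<bar> \<le> y"
  shows "\<bar>r *\<^sub>R x\<bar> \<le> r *\<^sub>R y"
proof (rule abs_leI)
  have "x \<le> y" "- x \<le> y"
    using assms(2) abs_ge_self[of x] abs_ge_minus_self[of x] by (auto intro: order_trans)
  then have "r *\<^sub>R x \<le> r *\<^sub>R y" "r *\<^sub>R (- x) \<le> r *\<^sub>R y"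
    using assms(1) by (blast intro: scaleR_left_mono)+
  then show "r *\<^sub>R x \<le> r *\<^sub>R y" "- (r *\<^sub>R x) \<le> r *\<^sub>R y"
    by simp_all
qed

text \<open>
  The Archimedean axiom only speaks of positive elements; for a general difference \<open>x - y\<close> it is
  applied to the positive part.
\<close>

lemma le_if_le_add_all_scaled:
  fixes x y z :: "'a::archimedean_vector_lattice"
  assumes "0 \<le> z" and le: "\<And>\<eta>. 0 < \<eta> \<Longrightarrow> x \<le> y + \<eta> *\<^sub>R z"
  shows "x \<le> y"
proof -
  define p where "p = sup (x - y) 0"
  have p_le: "p \<le> \<eta> *\<^sub>R z" if "0 < \<eta>" for \<eta>
    using le[OF that] assms(1) that
    by (simp add: p_def diff_le_eq add.commute scaleR_nonneg_nonneg)
  have "real n *\<^sub>R p \<le> z" for n :: nat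
  proof (cases "n = 0")
    case True
    then show ?thesis using assms(1) by simp
  next
    case False
    then have "real n *\<^sub>R p \<le> real n *\<^sub>R ((1 / real n) *\<^sub>R z)"
      by (intro scaleR_left_mono p_le) simp_all
    then show ?thesis using False by simp
  qed
  then have "p = 0"
    using archimedean_vl[of p z] assms(1) by (simp add: p_def)
  then show ?thesis
    by (metis p_def sup.cobounded1 diff_le_0_iff_le)
qed

section \<open>Right-tagged Riemann sums\<close>

definition right_sum :: "(real \<Rightarrow> 'a::real_vector) \<Rightarrow> (nat \<Rightarrow> real) \<Rightarrow> nat \<Rightarrow> 'a" where
  "right_sum f p n = (\<Sum>i=1..n. (p i - p (i - 1)) *\<^sub>R f (p i))"

text \<open>
  One choice of tags is enough to pin down the integral, and tagging each interval at its right end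
  leaves only the partition to be constructed. The regulator is positive because a sufficiently fine
  partition exists: it dominates the modulus of the corresponding error.
\<close>

lemma has_ru_integral_right_sum:
  fixes f :: "real \<Rightarrow> 'a::vector_lattice"
  assumes "0 \<le> s" "has_ru_integral f s I"
  obtains u where "0 \<le> u"
    "\<And>\<eta>. 0 < \<eta> \<Longrightarrow> \<exists>\<delta>>0. \<forall>n p. is_partition 0 s n p \<and> (\<forall>i\<in>{1..n}. \<bar>p i - p (i - 1)\<bar> \<le> \<delta>)
      \<longrightarrow> \<bar>right_sum f p n - I\<bar> \<le> \<eta> *\<^sub>R u"
proof -
  obtain u where u: "\<forall>\<epsilon>>0. \<exists>\<delta>>0. \<forall>n p \<tau>.
      is_partition 0 s n p \<and> (\<forall>i\<in>{1..n}. \<bar>p i - p (i - 1)\<bar> \<le> \<delta>) \<and>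
      (\<forall>i\<in>{1..n}. \<tau> i \<in> {p (i - 1)..p i}) \<longrightarrow>
      \<bar>(\<Sum>i=1..n. (p i - p (i - 1)) *\<^sub>R f (\<tau> i)) - I\<bar> \<le> \<epsilon> *\<^sub>R u"
    using assms(2) unfolding has_ru_integral_def by blast
  have approx: "\<exists>\<delta>>0. \<forall>n p. is_partition 0 s n p \<and> (\<forall>i\<in>{1..n}. \<bar>p i - p (i - 1)\<bar> \<le> \<delta>)
      \<longrightarrow> \<bar>right_sum f p n - I\<bar> \<le> \<eta> *\<^sub>R u" if \<eta>: "0 < \<eta>" for \<eta> :: real
  proof -
    obtain \<delta> where \<delta>: "\<delta> > 0" "\<forall>n p \<tau>.
        is_partition 0 s n p \<and> (\<forall>i\<in>{1..n}. \<bar>p i - p (i - 1)\<bar> \<le> \<delta>) \<and>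
        (\<forall>i\<in>{1..n}. \<tau> i \<in> {p (i - 1)..p i}) \<longrightarrow>
        \<bar>(\<Sum>i=1..n. (p i - p (i - 1)) *\<^sub>R f (\<tau> i)) - I\<bar> \<le> \<eta> *\<^sub>R u"
      using u[THEN spec, THEN mp, OF \<eta>] by (elim exE conjE) (rule that)
    have "\<bar>right_sum f p n - I\<bar> \<le> \<eta> *\<^sub>R u"
      if part: "is_partition 0 s n p" and mesh: "\<forall>i\<in>{1..n}. \<bar>p i - p (i - 1)\<bar> \<le> \<delta>" for n p
    proof -
      have tags: "\<forall>i\<in>{1..n}. p i \<in> {p (i - 1)..p i}"
        using part by (auto simp: is_partition_def intro: less_imp_le)
      show ?thesis
        using \<delta>(2)[THEN spec[of _ n], THEN spec[of _ p], THEN spec[of _ p]] part mesh tags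
        by (simp add: right_sum_def)
    qed
    with \<delta>(1) show ?thesis by blast
  qed
  obtain \<delta> where \<delta>: "\<delta> > 0" "\<And>n p. is_partition 0 s n p \<Longrightarrow>
      \<forall>i\<in>{1..n}. \<bar>p i - p (i - 1)\<bar> \<le> \<delta> \<Longrightarrow> \<bar>right_sum f p n - I\<bar> \<le> 1 *\<^sub>R u"
    using approx[of 1] by auto
  obtain n p where "is_partition 0 s n p" "\<forall>i\<in>{1..n}. \<bar>p i - p (i - 1)\<bar> \<le> \<delta>"
    using fine_partition_exists[OF assms(1) \<delta>(1)] .
  then have "\<bar>right_sum f p n - I\<bar> \<le> u"
    using \<delta>(2) by simp
  then have "0 \<le> u"
    using abs_ge_zero order_trans by blast
  then show thesis
    using approx by (rule that)
qed

lemma fine_partition_through: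
  fixes a b \<delta> :: real
  assumes "0 \<le> a" "a \<le> b" "0 < \<delta>"
  obtains m n p where "is_partition 0 a m p" "is_partition 0 b (m + n) p"
    "\<forall>i\<in>{1..m + n}. \<bar>p i - p (i - 1)\<bar> \<le> \<delta>"
proof -
  obtain m q where q: "is_partition 0 a m q" "\<forall>i\<in>{1..m}. \<bar>q i - q (i - 1)\<bar> \<le> \<delta>"
    using fine_partition_exists[OF assms(1,3)] .
  obtain n r where r: "is_partition 0 (b - a) n r" "\<forall>i\<in>{1..n}. \<bar>r i - r (i - 1)\<bar> \<le> \<delta>"
    using fine_partition_exists[of "b - a" \<delta>] assms(2,3) by auto
  define p where "p i = (if i \<le> m then q i else a + r (i - m))" for i
  have p_right: "p (m + j) = a + r j" for j
    using q(1) r(1) by (cases j) (auto simp: p_def is_partition_def)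
  have step: "p (i - 1) < p i \<and> \<bar>p i - p (i - 1)\<bar> \<le> \<delta>" if "i \<in> {1..m + n}" for i
  proof (cases "i \<le> m")
    case True
    then show ?thesis
      using that q by (auto simp: p_def is_partition_def)
  next
    case False
    define j where "j = i - m"
    have j: "j \<in> {1..n}" "i = m + j" "i - 1 = m + (j - 1)"
      using False that by (auto simp: j_def)
    show ?thesis
      unfolding j(3) unfolding j(2) p_right using r j(1) by (auto simp: is_partition_def)
  qed
  show thesis
  proof (rule that[of m p n])
    show "is_partition 0 a m p"
      using q(1) by (auto simp: is_partition_def p_def)
    show "is_partition 0 b (m + n) p"
      using q(1) r(1) step p_right[of n] by (auto simp: is_partition_def p_def)
    show "\<forall>i\<in>{1..m + n}. \<bar>p i - p (i - 1)\<bar> \<le> \<delta>"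
      using step by blast
  qed
qed

lemma partition_mono:
  assumes "is_partition a b n p" "i \<le> j" "j \<le> n"
  shows "p i \<le> p j"
  using assms(2,3)
proof (induction j rule: dec_induct)
  case (step k)
  then have "p (Suc k - 1) < p (Suc k)"
    using assms(1) unfolding is_partition_def by (metis atLeastAtMost_iff le_add1 plus_1_eq_Suc)
  with step show ?case by simp
qed simp

text \<open>
  The terms beyond the point \<open>a\<close> of the partition have weights that telescope to \<open>b - a\<close>, so the
  difference of the two sums is \<open>b - a\<close> times a convex combination of values of \<open>f\<close> on \<open>[a,b]\<close>.
\<close>

lemma right_sum_tail_estimate:
  fixes f :: "real \<Rightarrow> 'a::vector_lattice"
  assumes pa: "is_partition 0 a m p" and pb: "is_partition 0 b (m + n) p"
    and close: "\<And>r. a \<le> r \<Longrightarrow> r \<le> b \<Longrightarrow> \<bar>f r - c\<bar> \<le> K"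
  shows "\<bar>right_sum f p (m + n) - right_sum f p m - (b - a) *\<^sub>R c\<bar> \<le> (b - a) *\<^sub>R K"
proof -
  let ?w = "\<lambda>i. p i - p (i - 1)"
  let ?T = "{m + 1..m + n}"
  have ends: "p m = a" "p (m + n) = b"
    using pa pb by (auto simp: is_partition_def)
  have weights: "(\<Sum>i\<in>?T. ?w i) = b - a"
    using sum_telescope''[of m "m + n" p] ends by simp
  have "right_sum f p (m + n) - right_sum f p m = (\<Sum>i\<in>?T. ?w i *\<^sub>R f (p i))"
    unfolding right_sum_def by (subst sum.ub_add_nat) simp_all
  moreover have "(b - a) *\<^sub>R c = (\<Sum>i\<in>?T. ?w i *\<^sub>R c)"
    by (simp only: weights[symmetric] scaleR_sum_left)
  ultimately have "right_sum f p (m + n) - right_sum f p m - (b - a) *\<^sub>R c = (\<Sum>i\<in>?T. ?w i *\<^sub>R (f (p i) - c))"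
    by (simp only: scaleR_diff_right sum_subtractf)
  then have "\<bar>right_sum f p (m + n) - right_sum f p m - (b - a) *\<^sub>R c\<bar>
      \<le> (\<Sum>i\<in>?T. \<bar>?w i *\<^sub>R (f (p i) - c)\<bar>)"
    using sum_abs by metis
  also have "\<dots> \<le> (\<Sum>i\<in>?T. ?w i *\<^sub>R K)"
  proof (rule sum_mono)
    fix i assume i: "i \<in> ?T"
    have "a \<le> p i" "p i \<le> b" "0 \<le> ?w i"
      using i ends partition_mono[OF pb, of m i] partition_mono[OF pb, of i "m + n"]
        partition_mono[OF pb, of "i - 1" i] by auto
    then show "\<bar>?w i *\<^sub>R (f (p i) - c)\<bar> \<le> ?w i *\<^sub>R K"
      by (intro abs_scaleR_le close)
  qed
  also have "\<dots> = (b - a) *\<^sub>R K"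
    by (simp only: weights[symmetric] scaleR_sum_left)
  finally show ?thesis .
qed

section \<open>The fundamental theorem of calculus\<close>

lemma has_ru_integral_ru_integral:
  fixes f :: "real \<Rightarrow> 'a::archimedean_vector_lattice"
  assumes "ru_integrable f" "0 \<le> s"
  shows "has_ru_integral f s (ru_integral f s)"
  using assms ru_integral_eqI unfolding ru_integrable_def by blast

text \<open>
  Both integrals are approximated along one partition through \<open>a\<close>, where the tail estimate applies.
\<close>

lemma ru_integral_mean_value_estimate:
  fixes f :: "real \<Rightarrow> 'a::archimedean_vector_lattice"
  assumes int: "ru_integrable f" and ab: "0 \<le> a" "a \<le> b"
    and close: "\<And>r. a \<le> r \<Longrightarrow> r \<le> b \<Longrightarrow> \<bar>f r - c\<bar> \<le> K"
  shows "\<bar>ru_integral f b - ru_integral f a - (b - a) *\<^sub>R c\<bar> \<le> (b - a) *\<^sub>R K"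
proof -
  let ?A = "ru_integral f a" and ?B = "ru_integral f b"
  have b0: "0 \<le> b" using ab by simp
  obtain v where v: "0 \<le> v"
    "\<And>\<eta>. 0 < \<eta> \<Longrightarrow> \<exists>\<delta>>0. \<forall>n p. is_partition 0 a n p \<and> (\<forall>i\<in>{1..n}. \<bar>p i - p (i - 1)\<bar> \<le> \<delta>)
      \<longrightarrow> \<bar>right_sum f p n - ?A\<bar> \<le> \<eta> *\<^sub>R v"
    using has_ru_integral_right_sum[OF ab(1) has_ru_integral_ru_integral[OF int ab(1)]] by blast
  obtain w where w: "0 \<le> w"
    "\<And>\<eta>. 0 < \<eta> \<Longrightarrow> \<exists>\<delta>>0. \<forall>n p. is_partition 0 b n p \<and> (\<forall>i\<in>{1..n}. \<bar>p i - p (i - 1)\<bar> \<le> \<delta>)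
      \<longrightarrow> \<bar>right_sum f p n - ?B\<bar> \<le> \<eta> *\<^sub>R w"
    using has_ru_integral_right_sum[OF b0 has_ru_integral_ru_integral[OF int b0]] by blast
  have "\<bar>?B - ?A - (b - a) *\<^sub>R c\<bar> \<le> (b - a) *\<^sub>R K + \<eta> *\<^sub>R (v + w)" if \<eta>: "0 < \<eta>" for \<eta>
  proof -
    obtain d where d: "d > 0" "\<And>n p. is_partition 0 a n p \<Longrightarrow>
        \<forall>i\<in>{1..n}. \<bar>p i - p (i - 1)\<bar> \<le> d \<Longrightarrow> \<bar>right_sum f p n - ?A\<bar> \<le> \<eta> *\<^sub>R v"
      using v(2)[OF \<eta>] by auto
    obtain e where e: "e > 0" "\<And>n p. is_partition 0 b n p \<Longrightarrow>
        \<forall>i\<in>{1..n}. \<bar>p i - p (i - 1)\<bar> \<le> e \<Longrightarrow> \<bar>right_sum f p n - ?B\<bar> \<le> \<eta> *\<^sub>R w"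
      using w(2)[OF \<eta>] by auto
    have de: "0 < min d e" using d(1) e(1) by simp
    obtain m n p where p: "is_partition 0 a m p" "is_partition 0 b (m + n) p"
      "\<forall>i\<in>{1..m + n}. \<bar>p i - p (i - 1)\<bar> \<le> min d e"
      using fine_partition_through[OF ab de] .
    let ?S = "right_sum f p m" and ?S' = "right_sum f p (m + n)"
    let ?R = "?S' - ?S - (b - a) *\<^sub>R c"
    have mesh: "\<bar>p i - p (i - 1)\<bar> \<le> d" "\<bar>p i - p (i - 1)\<bar> \<le> e" if "i \<in> {1..m + n}" for i
      using p(3)[rule_format, OF that] by linarith+
    have errA: "\<bar>?S - ?A\<bar> \<le> \<eta> *\<^sub>R v"
      by (intro d(2) p(1) ballI mesh(1)) simp
    have errB: "\<bar>?S' - ?B\<bar> \<le> \<eta> *\<^sub>R w"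
      by (intro e(2) p(2) ballI mesh(2))
    have tail: "\<bar>?R\<bar> \<le> (b - a) *\<^sub>R K"
      by (rule right_sum_tail_estimate[OF p(1,2) close])
    have "?B - ?A - (b - a) *\<^sub>R c = ?R + ((?S - ?A) - (?S' - ?B))"
      by (simp only: algebra_simps)
    also have "\<bar>\<dots>\<bar> \<le> \<bar>?R\<bar> + \<bar>(?S - ?A) - (?S' - ?B)\<bar>"
      by (rule abs_triangle_ineq)
    also have "\<dots> \<le> \<bar>?R\<bar> + (\<bar>?S - ?A\<bar> + \<bar>?S' - ?B\<bar>)"
      by (intro add_left_mono abs_triangle_ineq4)
    also have "\<dots> \<le> (b - a) *\<^sub>R K + (\<eta> *\<^sub>R v + \<eta> *\<^sub>R w)"
      using errA errB tail by (intro add_mono)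
    finally show ?thesis
      by (simp add: scaleR_add_right)
  qed
  moreover have "0 \<le> v + w"
    using v(1) w(1) by simp
  ultimately show ?thesis
    by (blast intro: le_if_le_add_all_scaled)
qed

theorem proposition3p4:
  fixes f :: "real \<Rightarrow> 'a::archimedean_vector_lattice"
  assumes "ru_continuous f" and "ru_integrable f"
  shows "ru_integral f has_ru_derivative f"
proof -
  let ?F = "ru_integral f"
  obtain u where u: "\<And>\<epsilon>. 0 < \<epsilon> \<Longrightarrow> \<exists>\<delta>>0. \<forall>t\<ge>0. \<forall>h\<in>{- min \<delta> t..\<delta>}.
      \<bar>f (t + h) - f t\<bar> \<le> \<epsilon> *\<^sub>R u t"
    using assms(1) unfolding ru_continuous_def by blast
  have "\<exists>\<delta>>0. \<forall>t\<ge>0. \<forall>h\<in>{- min \<delta> t..\<delta>}. h \<noteq> 0 \<longrightarrow>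
      \<bar>(?F (t + h) - ?F t) /\<^sub>R h - f t\<bar> \<le> \<epsilon> *\<^sub>R u t" if \<epsilon>: "0 < \<epsilon>" for \<epsilon> :: real
  proof -
    obtain \<delta> where \<delta>: "0 < \<delta>"
      "\<And>t h. 0 \<le> t \<Longrightarrow> h \<in> {- min \<delta> t..\<delta>} \<Longrightarrow> \<bar>f (t + h) - f t\<bar> \<le> \<epsilon> *\<^sub>R u t"
      using u[OF \<epsilon>] by blast
    have "\<bar>(?F (t + h) - ?F t) /\<^sub>R h - f t\<bar> \<le> \<epsilon> *\<^sub>R u t"
      if t: "0 \<le> t" and h: "h \<in> {- min \<delta> t..\<delta>}" "h \<noteq> 0" for t h
    proof -
      define a b where "a = min t (t + h)" and "b = max t (t + h)"
      have ab: "0 \<le> a" "a < b" "b - a = \<bar>h\<bar>"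
        using t h by (auto simp: a_def b_def)
      have close: "\<bar>f r - f t\<bar> \<le> \<epsilon> *\<^sub>R u t" if "a \<le> r" "r \<le> b" for r
        using \<delta>(2)[OF t, of "r - t"] that h t \<delta>(1)
        by (auto simp: a_def b_def min_def max_def split: if_splits)
      have est: "\<bar>?F b - ?F a - (b - a) *\<^sub>R f t\<bar> \<le> (b - a) *\<^sub>R (\<epsilon> *\<^sub>R u t)"
        using ab by (intro ru_integral_mean_value_estimate assms(2) close) auto
      \<comment> \<open>For negative \<open>h\<close> both the increment of the integral and \<open>h\<close> change sign.\<close>
      have "(?F (t + h) - ?F t) /\<^sub>R h = (?F b - ?F a) /\<^sub>R (b - a)"
      proof (cases "0 < h")
        case True
        then show ?thesis by (simp add: a_def b_def)
      next
        case False
        then have "a = t + h" "b = t" by (simp_all add: a_def b_def)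
        then have "(?F b - ?F a) /\<^sub>R (b - a) = (- (?F (t + h) - ?F t)) /\<^sub>R (- h)"
          by simp
        then show ?thesis
          by (simp only: inverse_minus_eq scaleR_minus_left scaleR_minus_right minus_minus)
      qed
      also have "\<dots> - f t = (?F b - ?F a - (b - a) *\<^sub>R f t) /\<^sub>R (b - a)"
        using ab(2) by (simp add: scaleR_diff_right)
      finally have "(?F (t + h) - ?F t) /\<^sub>R h - f t = (?F b - ?F a - (b - a) *\<^sub>R f t) /\<^sub>R (b - a)" .
      moreover have "\<bar>(?F b - ?F a - (b - a) *\<^sub>R f t) /\<^sub>R (b - a)\<bar>
          \<le> ((b - a) *\<^sub>R (\<epsilon> *\<^sub>R u t)) /\<^sub>R (b - a)"
        by (rule abs_scaleR_le[OF _ est]) (use ab(2) in simp)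
      moreover have "((b - a) *\<^sub>R x) /\<^sub>R (b - a) = x" for x :: 'a
        using ab(2) by simp
      ultimately show ?thesis by (simp only:)
    qed
    with \<delta>(1) show ?thesis by blast
  qed
  then show ?thesis
    unfolding has_ru_derivative_def by blast
qed

end
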